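(* No finite graph is $4$-sac.
   Context: A finite graph is a nondegenerate continuum (compact connected metric space with more than one point) which is the union of finitely many arcs, any two of which are disjoint or meet only in one or both of their end points. An arc in a space $X$ is a homeomorphic embedding $\alpha:[0,1]\to X$ (or its image). A topological space $X$ is $n$-strongly arc connected ($n$-sac) if for every $n$ distinct points $x_1,\dots,x_n$ of $X$ there are an arc $\alpha:[0,1]\to X$ and $t_1<t_2<\dots<t_n$ in $[0,1]$ such that $\alpha(t_i)=x_i$ for $i=1,\dots,n$. *)

theory Defs
  imports "HOL-Analysis.Analysis"
begin

definition arc_map :: "'a topology \<Rightarrow> (real \<Rightarrow> 'a) \<Rightarrow> bool" where
  "arc_map X \<alpha> \<longleftrightarrow> embedding_map (top_of_set {0..1}) X \<alpha>"

definition nondegenerate_continuum :: "'a topology \<Rightarrow> bool" where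
  "nondegenerate_continuum X \<longleftrightarrow>
     metrizable_space X \<and> compact_space X \<and> connected_space X \<and>
     (\<exists>x\<in>topspace X. \<exists>y\<in>topspace X. x \<noteq> y)"

text \<open>The arcs of the decomposition are given by parametrisations, so the end points of
  \<open>\<alpha>\<close> are \<open>\<alpha> 0\<close> and \<open>\<alpha> 1\<close>. Two distinct parametrisations in the family always have
  distinct images, since an arc is not contained in the set of its end points.\<close>

definition finite_graph :: "'a topology \<Rightarrow> bool" where
  "finite_graph X \<longleftrightarrow>
     nondegenerate_continuum X \<and>
     (\<exists>E. finite E \<and> (\<forall>\<alpha>\<in>E. arc_map X \<alpha>) \<and>
          topspace X = (\<Union>\<alpha>\<in>E. \<alpha> ` {0..1}) \<and>
          pairwise (\<lambda>\<alpha> \<beta>. \<alpha> ` {0..1} \<inter> \<beta> ` {0..1} \<subseteq> {\<alpha> 0, \<alpha> 1} \<inter> {\<beta> 0, \<beta> 1}) E)"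

definition strongly_arc_connected :: "nat \<Rightarrow> 'a topology \<Rightarrow> bool" where
  "strongly_arc_connected n X \<longleftrightarrow>
     (\<forall>x. x ` {1..n} \<subseteq> topspace X \<and> inj_on x {1..n} \<longrightarrow>
        (\<exists>\<alpha> t. arc_map X \<alpha> \<and> t ` {1..n} \<subseteq> {0..1} \<and> strict_mono_on {1..n} t \<and>
               (\<forall>i\<in>{1..n}. \<alpha> (t i) = x i)))"

end

theory Submission
  imports Defs
begin

text \<open>
  An edge \<open>\<alpha>\<close> of a finite graph contains an arc \<open>\<alpha> ` {1/4..3/4}\<close> whose interior is open in the
  whole space, because no other edge reaches the interior of \<open>\<alpha>\<close>. Hence the two points
  \<open>\<alpha> (1/4)\<close> and \<open>\<alpha> (3/4)\<close> separate \<open>\<alpha> (1/2)\<close> from \<open>\<alpha> 0\<close>. An arc that visits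
  \<open>\<alpha> (1/2), \<alpha> 0, \<alpha> (1/4), \<alpha> (3/4)\<close> in this order is impossible: its part between the first two
  points is connected, and by injectivity it avoids the last two. So the obstruction to being
  4-sac is two points separating two others (\<open>not_4_sac_if_two_points_separate\<close>), and
  \<open>edge_middle_openin\<close> provides it in a finite graph.
\<close>

lemma arc_map_continuous_map:
  assumes "arc_map X \<alpha>"
  shows "continuous_map (top_of_set {0..1}) X \<alpha>"
  using assms continuous_map_in_subtopology homeomorphic_imp_continuous_map
  unfolding arc_map_def embedding_map_def by blast

lemma arc_map_closedin_image:
  assumes "arc_map X \<alpha>" "Hausdorff_space X" "0 \<le> a" "b \<le> 1"
  shows "closedin X (\<alpha> ` {a..b})"
proof -
  have "compactin (top_of_set {0..1::real}) {a..b}"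
    using assms(3,4) by (auto simp: compactin_subtopology)
  moreover have "continuous_map (top_of_set {0..1}) X \<alpha>"
    using assms(1) by (rule arc_map_continuous_map)
  ultimately show ?thesis
    using assms(2) compactin_imp_closedin image_compactin by blast
qed

lemma arc_map_inj_on:
  assumes "arc_map X \<alpha>"
  shows "inj_on \<alpha> {0..1}"
  using assms homeomorphic_imp_injective_map[of "top_of_set {0..1}" _ \<alpha>]
  by (simp add: arc_map_def embedding_map_def)

text \<open>The complement is a finite union of compact sets: the other edges and the two outer quarters
  of \<open>\<alpha>\<close>.\<close>

lemma edge_middle_openin:
  assumes X: "Hausdorff_space X" and E: "finite E" "\<forall>\<beta>\<in>E. arc_map X \<beta>"
    and cover: "topspace X = (\<Union>\<beta>\<in>E. \<beta> ` {0..1})"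
    and meet: "pairwise (\<lambda>\<alpha> \<beta>. \<alpha> ` {0..1} \<inter> \<beta> ` {0..1} \<subseteq> {\<alpha> 0, \<alpha> 1} \<inter> {\<beta> 0, \<beta> 1}) E"
    and \<alpha>: "\<alpha> \<in> E"
  shows "openin X (\<alpha> ` {1/4<..<3/4})"
proof -
  define U where "U = \<alpha> ` {1/4<..<3/4}"
  define L where "L = \<alpha> ` {0..1/4}"
  define R where "R = \<alpha> ` {3/4..1}"
  define W where "W = (\<Union>\<beta>\<in>E - {\<alpha>}. \<beta> ` {0..1})"
  have inj: "inj_on \<alpha> {0..1}"
    using E(2) \<alpha> arc_map_inj_on by blast
  have ends: "\<alpha> 0 \<notin> U" "\<alpha> 1 \<notin> U" and LR: "L \<inter> U = {}" "R \<inter> U = {}"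
    unfolding U_def L_def R_def by (auto simp: inj_on_eq_iff[OF inj])
  have split: "\<alpha> ` {0..1} = L \<union> U \<union> R"
  proof -
    have "{0..1} = {0..1/4} \<union> {1/4<..<3/4} \<union> {3/4..1::real}"
      by auto
    then show ?thesis
      unfolding U_def L_def R_def by (simp only: image_Un)
  qed
  have "y \<notin> U" if "y \<in> W" for y
  proof -
    from that obtain \<beta> where \<beta>: "\<beta> \<in> E" "\<alpha> \<noteq> \<beta>" "y \<in> \<beta> ` {0..1}"
      unfolding W_def by blast
    then have "\<alpha> ` {0..1} \<inter> \<beta> ` {0..1} \<subseteq> {\<alpha> 0, \<alpha> 1}"
      using pairwiseD[OF meet \<alpha>, of \<beta>] by simp
    then show ?thesis
      using ends \<beta>(3) split by auto
  qed
  moreover have "topspace X = W \<union> \<alpha> ` {0..1}"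
    unfolding cover W_def using \<alpha> by auto
  ultimately have "U = topspace X - (W \<union> L \<union> R)"
    using LR split by auto
  moreover have "closedin X W"
    unfolding W_def using E X by (intro closedin_Union) (auto intro!: arc_map_closedin_image)
  moreover have "closedin X L" "closedin X R"
    unfolding L_def R_def using E X \<alpha> by (auto intro!: arc_map_closedin_image)
  ultimately show ?thesis
    unfolding U_def[symmetric] by (simp add: closedin_Un openin_diff)
qed

text \<open>The separation of \<open>b\<close> from \<open>d\<close> by \<open>a\<close> and \<open>c\<close> is given by disjoint open sets \<open>U\<close> and \<open>V\<close>
  covering the rest of the space. The contradiction comes from the visiting order \<open>b, d, a, c\<close>.\<close>

lemma not_4_sac_if_two_points_separate:
  assumes U: "openin X U" "b \<in> U" and V: "openin X V" "d \<in> V"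
    and disj: "U \<inter> V = {}" and cover: "topspace X - {a, c} \<subseteq> U \<union> V"
    and ac: "a \<in> topspace X" "c \<in> topspace X" "a \<noteq> c" "a \<notin> U \<union> V" "c \<notin> U \<union> V"
  shows "\<not> strongly_arc_connected 4 X"
proof
  assume sac: "strongly_arc_connected 4 X"
  define x where "x = (\<lambda>i::nat. if i = 1 then b else if i = 2 then d else if i = 3 then a else c)"
  have four: "{1..4} = {1, 2, 3, 4::nat}"
    by auto
  have "b \<in> topspace X" "d \<in> topspace X"
    using U V openin_subset by blast+
  moreover have "b \<noteq> d" "a \<noteq> b" "a \<noteq> d" "c \<noteq> b" "c \<noteq> d"
    using U V disj ac by blast+
  ultimately have "x ` {1..4} \<subseteq> topspace X \<and> inj_on x {1..4}"
    using ac unfolding four x_def by auto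
  from sac[unfolded strongly_arc_connected_def, rule_format, OF this] obtain \<gamma> t where \<gamma>: "arc_map X \<gamma>" and t: "t ` {1..4} \<subseteq> {0..1}"
    and mono: "strict_mono_on {1..4} t" and visit: "\<forall>i\<in>{1..4}. \<gamma> (t i) = x i"
    by blast
  have t_less: "t 1 < t 2" "t 2 < t 3" "t 3 < t 4"
    using mono by (auto simp: strict_mono_on_def)
  have t_in: "t 1 \<in> {0..1}" "t 2 \<in> {0..1}" "t 3 \<in> {0..1}" "t 4 \<in> {0..1}"
    using t unfolding four by auto
  have vals: "\<gamma> (t 1) = b" "\<gamma> (t 2) = d" "\<gamma> (t 3) = a" "\<gamma> (t 4) = c"
    using visit unfolding four by (auto simp: x_def)
  let ?C = "\<gamma> ` {t 1..t 2}"
  have "continuous_map (top_of_set {0..1}) X \<gamma>"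
    using \<gamma> by (rule arc_map_continuous_map)
  moreover have "connectedin (top_of_set {0..1}) {t 1..t 2}"
    using t_in by (auto simp: connectedin_subtopology)
  ultimately have conn: "connectedin X ?C"
    by (rule connectedin_continuous_map_image)
  have "\<gamma> s \<noteq> \<gamma> r" if "s \<in> {t 1..t 2}" "r \<in> {t 3, t 4}" for s r
    using that t_in t_less inj_onD[OF arc_map_inj_on[OF \<gamma>], of s r] by fastforce
  then have "a \<notin> ?C" "c \<notin> ?C"
    using vals by force+
  then have "?C \<subseteq> U \<union> V"
    using conn cover connectedin_subset_topspace by blast
  moreover have "b \<in> ?C" "d \<in> ?C"
    using vals t_less by force+
  ultimately show False
    using conn U V disj unfolding connectedin by blast
qed

theorem mainTheorem7:
  fixes X :: "'a topology"
  assumes "finite_graph X"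
  shows "\<not> strongly_arc_connected 4 X"
proof -
  obtain E where ndc: "nondegenerate_continuum X"
    and E: "finite E" "\<forall>\<alpha>\<in>E. arc_map X \<alpha>"
    and cover: "topspace X = (\<Union>\<alpha>\<in>E. \<alpha> ` {0..1})"
    and meet: "pairwise (\<lambda>\<alpha> \<beta>. \<alpha> ` {0..1} \<inter> \<beta> ` {0..1} \<subseteq> {\<alpha> 0, \<alpha> 1} \<inter> {\<beta> 0, \<beta> 1}) E"
    using assms unfolding finite_graph_def by blast
  have X: "Hausdorff_space X"
    using ndc by (simp add: nondegenerate_continuum_def metrizable_imp_Hausdorff_space)
  obtain \<alpha> where \<alpha>: "\<alpha> \<in> E"
    using ndc cover unfolding nondegenerate_continuum_def by blast
  have arc: "arc_map X \<alpha>"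
    using E \<alpha> by blast
  have inj: "inj_on \<alpha> {0..1}"
    using arc by (rule arc_map_inj_on)
  let ?U = "\<alpha> ` {1/4<..<3/4}"
  let ?V = "topspace X - \<alpha> ` {1/4..3/4}"
  have in_X: "\<alpha> s \<in> topspace X" if "s \<in> {0..1}" for s
    using cover \<alpha> that by blast
  have middle: "\<alpha> ` {1/4..3/4} = ?U \<union> {\<alpha> (1/4), \<alpha> (3/4)}"
  proof -
    have "{1/4..3/4} = {1/4<..<3/4} \<union> {1/4, 3/4::real}"
      by auto
    then show ?thesis
      by (simp only: image_Un image_insert image_empty)
  qed
  show ?thesis
  proof (rule not_4_sac_if_two_points_separate)
    show "openin X ?U"
      using X E cover meet \<alpha> by (rule edge_middle_openin)
    show "openin X ?V"
      using arc_map_closedin_image[OF arc X] by (intro openin_diff) auto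
    show "\<alpha> (1/2) \<in> ?U"
      by auto
    show "\<alpha> 0 \<in> ?V"
      using in_X by (auto simp: inj_on_eq_iff[OF inj])
    show "?U \<inter> ?V = {}" "topspace X - {\<alpha> (1/4), \<alpha> (3/4)} \<subseteq> ?U \<union> ?V"
      unfolding middle by blast+
    show "\<alpha> (1/4) \<in> topspace X" "\<alpha> (3/4) \<in> topspace X"
      by (auto intro: in_X)
    show "\<alpha> (1/4) \<noteq> \<alpha> (3/4)" "\<alpha> (1/4) \<notin> ?U \<union> ?V" "\<alpha> (3/4) \<notin> ?U \<union> ?V"
      by (auto simp: inj_on_eq_iff[OF inj])
  qed
qed

end
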